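(* Let $S\subset\mathbb{R}^3$ be a rational real ruled surface properly parametrized by $\boldsymbol{x}(t,s)=\boldsymbol{p}(t)+s\cdot\boldsymbol{q}(t)$. An isometry $f:\mathbb{R}^3\to\mathbb{R}^3$, $f(\mathbf{x})=\boldsymbol{Q}\mathbf{x}+\boldsymbol{b}$, is a symmetry of $S$ if and only if there exists a unique birational transformation $\varphi:\mathbb{R}^2\dashrightarrow\mathbb{R}^2$ such that $f\circ\boldsymbol{x}=\boldsymbol{x}\circ\varphi$, i.e. $f(\boldsymbol{x}(t,s))=\boldsymbol{x}(\varphi(t,s))$ for generic $(t,s)\in\mathbb{R}^2$.
   Context: $\boldsymbol{p}(t),\boldsymbol{q}(t)$ are triples of real rational functions of $t$, with $\boldsymbol{q}$ not identically zero. The surface $S\subset\mathbb{R}^3$ is the irreducible real algebraic surface (Zariski closure of the image) parametrized by $\boldsymbol{x}$; some points of $S$ may be missed by $\boldsymbol{x}$. The parametrization is proper if $\boldsymbol{x}:\mathbb{R}^2\dashrightarrow S$ is birational, i.e. it is injective outside an at most $1$-dimensional subset and has a rational inverse $\boldsymbol{x}^{-1}$. An isometry of $\mathbb{R}^3$ is a map $f(\mathbf{x})=\boldsymbol{Q}\mathbf{x}+\boldsymbol{b}$ with $\boldsymbol{Q}$ a real orthogonal $3\times3$ matrix and $\boldsymbol{b}\in\mathbb{R}^3$; it is a symmetry of $S$ if $f(S)=S$. Birational transformations of $\mathbb{R}^2$ are given by real rational functions, and equality of rational maps means equality at generic points (where both are defined). *)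

theory Defs
  imports "HOL-Analysis.Analysis"
begin

text \<open>
  The Zariski topology on a real Euclidean space is expressed with
  \<^const>\<open>real_polynomial_function\<close>; no coordinates need to be chosen.
\<close>

definition zariski_closure :: "'a::euclidean_space set \<Rightarrow> 'a set" where
  "zariski_closure A =
     {z. \<forall>h. real_polynomial_function h \<and> (\<forall>a\<in>A. h a = 0) \<longrightarrow> h z = 0}"

text \<open>
  ``At generic points of V'': on a nonempty basic Zariski-open subset of V.  This is the usual
  notion for irreducible V, and it is only used for Euclidean spaces and for Zariski closures of
  images of rational maps defined on Euclidean spaces.
\<close>

definition generically :: "'a::euclidean_space set \<Rightarrow> ('a \<Rightarrow> bool) \<Rightarrow> bool" where
  "generically V P \<longleftrightarrow>
     (\<exists>h. real_polynomial_function h \<and> (\<exists>v\<in>V. h v \<noteq> 0) \<and> (\<forall>v\<in>V. h v \<noteq> 0 \<longrightarrow> P v))"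

text \<open>
  A rational map is represented by a vector of numerators and one common denominator.  Different
  representatives of the same rational map are identified by \<open>rat_eq\<close> below.
\<close>

type_synonym ('a, 'b) ratmap = "('a \<Rightarrow> 'b) \<times> ('a \<Rightarrow> real)"

definition rational_map ::
  "'a::euclidean_space set \<Rightarrow> ('a, 'b::euclidean_space) ratmap \<Rightarrow> bool" where
  "rational_map V F \<longleftrightarrow>
     polynomial_function (fst F) \<and> real_polynomial_function (snd F) \<and> (\<exists>v\<in>V. snd F v \<noteq> 0)"

definition rdom :: "('a, 'b::real_vector) ratmap \<Rightarrow> 'a set" where
  "rdom F = {v. snd F v \<noteq> 0}"

text \<open>The value \<open>rval F v\<close> is meaningful only for \<open>v \<in> rdom F\<close>.\<close>

definition rval :: "('a, 'b::real_vector) ratmap \<Rightarrow> 'a \<Rightarrow> 'b" where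
  "rval F v = fst F v /\<^sub>R snd F v"

definition rat_eq ::
  "'a::euclidean_space set \<Rightarrow> ('a, 'b::euclidean_space) ratmap \<Rightarrow> ('a, 'b) ratmap \<Rightarrow> bool" where
  "rat_eq V F G \<longleftrightarrow> generically V (\<lambda>v. v \<in> rdom F \<and> v \<in> rdom G \<and> rval F v = rval G v)"

text \<open>
  \<open>rat_left_inverse V W F G\<close>: F maps generic points of V into W, the composition of F with
  G is defined there (no division by zero is involved), and it is the identity of V as a
  rational map.
\<close>

definition rat_left_inverse ::
  "'a::euclidean_space set \<Rightarrow> 'b::euclidean_space set \<Rightarrow>
    ('a, 'b) ratmap \<Rightarrow> ('b, 'a) ratmap \<Rightarrow> bool" where
  "rat_left_inverse V W F G \<longleftrightarrow>
     generically V (\<lambda>v. v \<in> rdom F \<and> rval F v \<in> W \<and> rval F v \<in> rdom G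
                        \<and> rval G (rval F v) = v)"

definition birational ::
  "'a::euclidean_space set \<Rightarrow> 'b::euclidean_space set \<Rightarrow> ('a, 'b) ratmap \<Rightarrow> bool" where
  "birational V W F \<longleftrightarrow>
     rational_map V F \<and>
     (\<exists>G. rational_map W G \<and> rat_left_inverse V W F G \<and> rat_left_inverse W V G F)"

text \<open>
  The rational map $(t,s) \mapsto p(t) + s\,q(t)$, brought to a common denominator; see
  \<open>rdom_ruled_param\<close> and \<open>rval_ruled_param\<close>.
\<close>

definition ruled_param ::
  "(real, real^3) ratmap \<Rightarrow> (real, real^3) ratmap \<Rightarrow> (real \<times> real, real^3) ratmap" where
  "ruled_param p q =
     ((\<lambda>(t, s). snd q t *\<^sub>R fst p t + (s * snd p t) *\<^sub>R fst q t), (\<lambda>(t, s). snd p t * snd q t))"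

lemma rdom_ruled_param: "(t, s) \<in> rdom (ruled_param p q) \<longleftrightarrow> t \<in> rdom p \<and> t \<in> rdom q"
  by (simp add: rdom_def ruled_param_def)

lemma rval_ruled_param:
  assumes "t \<in> rdom p" "t \<in> rdom q"
  shows "rval (ruled_param p q) (t, s) = rval p t + s *\<^sub>R rval q t"
  using assms by (simp add: rdom_def rval_def ruled_param_def field_simps scaleR_add_right)

definition param_variety ::
  "('a::euclidean_space, 'b::euclidean_space) ratmap \<Rightarrow> 'b set" where
  "param_variety x = zariski_closure (rval x ` rdom x)"

text \<open>The identity $f \circ x = x \circ \varphi$ of rational maps.\<close>

definition lifts_to ::
  "('b \<Rightarrow> 'b) \<Rightarrow> ('a::euclidean_space, 'b::euclidean_space) ratmap \<Rightarrow> ('a, 'a) ratmap \<Rightarrow> bool" where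
  "lifts_to f x \<phi> \<longleftrightarrow>
     generically UNIV (\<lambda>u. u \<in> rdom x \<and> u \<in> rdom \<phi> \<and> rval \<phi> u \<in> rdom x
                           \<and> f (rval x u) = rval x (rval \<phi> u))"

end

theory Submission
  imports Defs
begin

text \<open>
  If \<open>f\<close> preserves \<open>S\<close> and \<open>G\<close> is the inverse of \<open>x\<close>, then \<open>\<phi> = G \<circ> f \<circ> x\<close> is birational with
  inverse \<open>G \<circ> f\<inverse> \<circ> x\<close>, and it is unique since any lift \<open>\<psi>\<close> satisfies
  \<open>\<psi> = G \<circ> x \<circ> \<psi> = G \<circ> f \<circ> x\<close>.  Conversely, if \<open>f \<circ> x = x \<circ> \<phi>\<close>, a polynomial vanishing on the
  image of \<open>x\<close> vanishes at \<open>f (x u)\<close> for generic \<open>u\<close>, hence for all \<open>u\<close>, so \<open>f\<close> maps \<open>S\<close> into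
  itself; as \<open>\<phi>\<close> is dominant, the same argument applies to \<open>f\<inverse>\<close>.
\<close>

section \<open>Generic conditions on a Euclidean space\<close>

lemma finite_real_polynomial_zeros:
  fixes g :: "real \<Rightarrow> real"
  assumes "real_polynomial_function g" "g t \<noteq> 0"
  shows "finite {t. g t = 0}"
proof -
  obtain a n where g: "g = (\<lambda>x. \<Sum>i\<le>n. a i * x ^ i)"
    using assms(1) real_polynomial_function_iff_sum by blast
  have "\<exists>i\<le>n. a i \<noteq> 0"
    using assms(2) unfolding g by (metis (no_types, lifting) atMost_iff mult_zero_left sum.neutral)
  then show ?thesis
    unfolding g by (simp add: polyfun_finite_roots)
qed

text \<open>Restricting to the line through \<open>a\<close> and \<open>b\<close> reduces the claim to one variable.\<close>

lemma real_polynomial_common_nonzero: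
  fixes g h :: "'a::euclidean_space \<Rightarrow> real"
  assumes g: "real_polynomial_function g" "g a \<noteq> 0"
    and h: "real_polynomial_function h" "h b \<noteq> 0"
  obtains v where "g v \<noteq> 0" "h v \<noteq> 0"
proof -
  define l where "l = (\<lambda>t::real. a + t *\<^sub>R (b - a))"
  have "polynomial_function l"
    unfolding l_def
    by (intro polynomial_function_add polynomial_function_mult polynomial_function_const)
       (simp add: real_polynomial_function_eq)
  then have "real_polynomial_function (g \<circ> l)" "real_polynomial_function (h \<circ> l)"
    using g h by (simp_all add: polynomial_function_compose real_polynomial_function_eq)
  moreover have "(g \<circ> l) 0 \<noteq> 0" "(h \<circ> l) 1 \<noteq> 0"
    using g h by (simp_all add: l_def)
  ultimately have "finite ({t. (g \<circ> l) t = 0} \<union> {t. (h \<circ> l) t = 0})"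
    using finite_real_polynomial_zeros by blast
  then obtain t where "t \<notin> {t. (g \<circ> l) t = 0} \<union> {t. (h \<circ> l) t = 0}"
    using ex_new_if_finite infinite_UNIV_char_0 by blast
  then show thesis
    using that[of "l t"] by auto
qed

lemma generically_mono:
  "generically V P \<Longrightarrow> (\<And>v. P v \<Longrightarrow> R v) \<Longrightarrow> generically V R"
  unfolding generically_def by blast

text \<open>This is irreducibility of Euclidean space: the product of the two witnessing polynomials
  is again not identically zero, since they share a point where neither vanishes.\<close>

lemma generically_conj:
  assumes "generically (UNIV :: 'a::euclidean_space set) P" "generically UNIV R"
  shows "generically UNIV (\<lambda>v. P v \<and> R v)"
proof -
  obtain g a where g: "real_polynomial_function g" "g a \<noteq> 0" "\<And>v. g v \<noteq> 0 \<Longrightarrow> P v"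
    using assms(1) unfolding generically_def by auto
  obtain h b where h: "real_polynomial_function h" "h b \<noteq> 0" "\<And>v. h v \<noteq> 0 \<Longrightarrow> R v"
    using assms(2) unfolding generically_def by auto
  obtain v where "g v \<noteq> 0" "h v \<noteq> 0"
    using real_polynomial_common_nonzero g h by metis
  with g h show ?thesis
    unfolding generically_def
    by (intro exI[of _ "\<lambda>v. g v * h v"] conjI real_polynomial_function.intros(4)) auto
qed

lemma generically_ex: "generically V P \<Longrightarrow> \<exists>v. P v"
  unfolding generically_def by blast

section \<open>Clearing denominators and composing rational maps\<close>

text \<open>Induction on how \<open>h\<close> is built: a linear form costs one factor
  \<open>D\<close>, a constant none, and sums and products add the exponents. Zeros of
  \<open>D\<close> are excluded because division by zero yields the value 0 there.\<close>

lemma real_polynomial_rational_comp: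
  assumes N: "polynomial_function N" and D: "real_polynomial_function D"
    and h: "real_polynomial_function h"
  shows "\<exists>k H. real_polynomial_function H \<and> (\<forall>u. D u \<noteq> 0 \<longrightarrow> H u = D u ^ k * h (N u /\<^sub>R D u))"
  using h
proof (induction rule: real_polynomial_function.induct)
  case (linear h)
  with N have "real_polynomial_function (h \<circ> N)"
    unfolding polynomial_function_def by blast
  with linear show ?case
    by (intro exI[of _ 1] exI[of _ "h \<circ> N"]) (simp add: linear_simps(5) comp_def)
next
  case (const c)
  show ?case
    by (intro exI[of _ 0] exI[of _ "\<lambda>u. c"]) (auto intro: real_polynomial_function.intros(2))
next
  case (add f g)
  then obtain k H l K where H: "real_polynomial_function H"
      "\<And>u. D u \<noteq> 0 \<Longrightarrow> H u = D u ^ k * f (N u /\<^sub>R D u)"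
    and K: "real_polynomial_function K"
      "\<And>u. D u \<noteq> 0 \<Longrightarrow> K u = D u ^ l * g (N u /\<^sub>R D u)"
    by blast
  \<comment> \<open>Cross-multiplication: each summand receives the power of \<open>D\<close>
    belonging to the other one.\<close>
  have "real_polynomial_function (\<lambda>u. D u ^ l * H u + D u ^ k * K u)"
    using D H(1) K(1) by (intro real_polynomial_function.intros(3,4) real_polynomial_function_power)
  with H(2) K(2) show ?case
    by (intro exI[of _ "k + l"] exI[of _ "\<lambda>u. D u ^ l * H u + D u ^ k * K u"])
       (simp add: power_add algebra_simps)
next
  case (mult f g)
  then obtain k H l K where H: "real_polynomial_function H"
      "\<And>u. D u \<noteq> 0 \<Longrightarrow> H u = D u ^ k * f (N u /\<^sub>R D u)"
    and K: "real_polynomial_function K"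
      "\<And>u. D u \<noteq> 0 \<Longrightarrow> K u = D u ^ l * g (N u /\<^sub>R D u)"
    by blast
  have "real_polynomial_function (\<lambda>u. H u * K u)"
    using H(1) K(1) by (intro real_polynomial_function.intros(3,4) real_polynomial_function_power)
  with H(2) K(2) show ?case
    by (intro exI[of _ "k + l"] exI[of _ "\<lambda>u. H u * K u"])
       (simp add: power_add algebra_simps)
qed

text \<open>
  Stated for all large exponents, so that several polynomials can be brought to one common
  denominator.
\<close>

lemma real_polynomial_rational_comp_eventually:
  assumes N: "polynomial_function N" and D: "real_polynomial_function D"
    and h: "real_polynomial_function h"
  shows "\<forall>\<^sub>F k in sequentially.
    \<exists>H. real_polynomial_function H \<and> (\<forall>u. D u \<noteq> 0 \<longrightarrow> H u = D u ^ k * h (N u /\<^sub>R D u))"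
proof -
  obtain l K where K: "real_polynomial_function K"
    "\<And>u. D u \<noteq> 0 \<Longrightarrow> K u = D u ^ l * h (N u /\<^sub>R D u)"
    using real_polynomial_rational_comp[OF assms] by blast
  have "\<exists>H. real_polynomial_function H \<and> (\<forall>u. D u \<noteq> 0 \<longrightarrow> H u = D u ^ k * h (N u /\<^sub>R D u))"
    if "l \<le> k" for k
  proof (intro exI[of _ "\<lambda>u. D u ^ (k - l) * K u"] conjI allI impI)
    show "real_polynomial_function (\<lambda>u. D u ^ (k - l) * K u)"
      using D K(1) by (intro real_polynomial_function.intros(4) real_polynomial_function_power)
    show "D u ^ (k - l) * K u = D u ^ k * h (N u /\<^sub>R D u)" if "D u \<noteq> 0" for u
      using K(2)[OF that] \<open>l \<le> k\<close> by (simp add: mult.assoc[symmetric] power_add[symmetric])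
  qed
  then show ?thesis
    by (rule eventually_sequentiallyI)
qed

text \<open>Each coordinate admits all large exponents and there are finitely many coordinates, so
  one exponent serves them all.\<close>

lemma polynomial_rational_comp_eventually:
  fixes h :: "'b::euclidean_space \<Rightarrow> 'c::euclidean_space"
  assumes N: "polynomial_function N" and D: "real_polynomial_function D"
    and h: "polynomial_function h"
  shows "\<forall>\<^sub>F k in sequentially.
    \<exists>H. polynomial_function H \<and> (\<forall>u. D u \<noteq> 0 \<longrightarrow> H u = D u ^ k *\<^sub>R h (N u /\<^sub>R D u))"
proof -
  have "\<forall>\<^sub>F k in sequentially. \<forall>i\<in>Basis.
      \<exists>H. real_polynomial_function H \<and> (\<forall>u. D u \<noteq> 0 \<longrightarrow> H u = D u ^ k * (h (N u /\<^sub>R D u) \<bullet> i))"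
    using h unfolding polynomial_function_iff_Basis_inner
    by (intro eventually_ball_finite finite_Basis ballI
        real_polynomial_rational_comp_eventually[OF N D]) auto
  then show ?thesis
  proof eventually_elim
    case (elim k)
    then obtain H where H: "\<And>i. i \<in> Basis \<Longrightarrow> real_polynomial_function (H i)"
      "\<And>i u. i \<in> Basis \<Longrightarrow> D u \<noteq> 0 \<Longrightarrow> H i u = D u ^ k * (h (N u /\<^sub>R D u) \<bullet> i)"
      by metis
    show ?case
    proof (intro exI[of _ "\<lambda>u. \<Sum>i\<in>Basis. H i u *\<^sub>R i"] conjI allI impI)
      show "polynomial_function (\<lambda>u. \<Sum>i\<in>Basis. H i u *\<^sub>R i)"
        using H(1) by (simp add: polynomial_function_iff_Basis_inner cong: sum.cong)
      show "(\<Sum>i\<in>Basis. H i u *\<^sub>R i) = D u ^ k *\<^sub>R h (N u /\<^sub>R D u)" if "D u \<noteq> 0" for u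
        using H(2)[OF _ that] by (intro euclidean_eqI[where 'a = 'c]) simp
    qed
  qed
qed

text \<open>Numerator and denominator of \<open>G\<close> are cleared with the same power of
  \<open>snd F\<close>, which then cancels in the quotient. The denominator of \<open>C\<close> may
  still vanish identically, namely if \<open>F\<close> maps its domain into the zeros of
  \<open>snd G\<close>; hence \<open>rational_map\<close> is not claimed.\<close>

lemma rational_comp:
  fixes F :: "('a::euclidean_space, 'b::euclidean_space) ratmap"
    and G :: "('b, 'c::euclidean_space) ratmap"
  assumes F: "polynomial_function (fst F)" "real_polynomial_function (snd F)"
    and G: "polynomial_function (fst G)" "real_polynomial_function (snd G)"
  obtains C :: "('a, 'c) ratmap"
  where "polynomial_function (fst C)" "real_polynomial_function (snd C)"
    "rdom C = {u \<in> rdom F. rval F u \<in> rdom G}"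
    "\<And>u. u \<in> rdom C \<Longrightarrow> rval C u = rval G (rval F u)"
proof -
  have "\<exists>k.
     (\<exists>M. polynomial_function M \<and>
       (\<forall>u. snd F u \<noteq> 0 \<longrightarrow> M u = snd F u ^ k *\<^sub>R fst G (fst F u /\<^sub>R snd F u))) \<and>
     (\<exists>E. real_polynomial_function E \<and>
       (\<forall>u. snd F u \<noteq> 0 \<longrightarrow> E u = snd F u ^ k * snd G (fst F u /\<^sub>R snd F u)))"
    by (rule eventually_happens'[OF sequentially_bot])
       (intro eventually_conj polynomial_rational_comp_eventually
         real_polynomial_rational_comp_eventually F G)
  then obtain k M E where M: "polynomial_function M"
      "\<And>u. snd F u \<noteq> 0 \<Longrightarrow> M u = snd F u ^ k *\<^sub>R fst G (rval F u)"
    and E: "real_polynomial_function E"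
      "\<And>u. snd F u \<noteq> 0 \<Longrightarrow> E u = snd F u ^ k * snd G (rval F u)"
    unfolding rval_def by blast
  \<comment> \<open>The extra factor \<open>snd F\<close> excludes points outside the domain of \<open>F\<close>.\<close>
  define C where "C = ((\<lambda>u. snd F u *\<^sub>R M u), (\<lambda>u. snd F u * E u))"
  show thesis
  proof
    show "polynomial_function (fst C)"
      unfolding C_def fst_conv
      using F(2) M(1) by (intro polynomial_function_mult) (simp_all add: real_polynomial_function_eq)
    show "real_polynomial_function (snd C)"
      unfolding C_def snd_conv using F(2) E(1) by (intro real_polynomial_function.intros(4))
    show "rdom C = {u \<in> rdom F. rval F u \<in> rdom G}"
      unfolding C_def rdom_def using E(2) by auto
    then show "rval C u = rval G (rval F u)" if "u \<in> rdom C" for u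
      using that M(2) E(2) unfolding rval_def[of C] rval_def[of G]
      by (auto simp: C_def rdom_def field_simps)
  qed
qed

section \<open>Generic conditions along rational maps\<close>

text \<open>A single good point suffices, because after clearing denominators the condition is the
  nonvanishing of one polynomial.\<close>

lemma generically_comp_nonzero:
  fixes F :: "('a::euclidean_space, 'b::euclidean_space) ratmap"
  assumes F: "rational_map UNIV F" and h: "real_polynomial_function h"
    and u: "u \<in> rdom F" "h (rval F u) \<noteq> 0"
  shows "generically UNIV (\<lambda>u. u \<in> rdom F \<and> h (rval F u) \<noteq> 0)"
proof -
  have "polynomial_function (fst F)" "real_polynomial_function (snd F)"
    using F by (simp_all add: rational_map_def)
  from real_polynomial_rational_comp[OF this h]
  obtain k H where H: "real_polynomial_function H"
    "\<And>u. snd F u \<noteq> 0 \<Longrightarrow> H u = snd F u ^ k * h (rval F u)"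
    unfolding rval_def by blast
  show ?thesis
    unfolding generically_def
  \<comment> \<open>The factor \<open>snd F\<close> forces \<open>u\<close> into the domain, where
    \<open>H\<close> is known to be a multiple of \<open>h (rval F u)\<close>.\<close>
  proof (intro exI[of _ "\<lambda>u. snd F u * H u"] conjI)
    show "real_polynomial_function (\<lambda>u. snd F u * H u)"
      using F H(1) unfolding rational_map_def by (intro real_polynomial_function.intros(4)) simp_all
  qed (use u H(2) in \<open>auto simp: rdom_def\<close>)
qed

text \<open>Nonvanishing at one point would itself be generic, and two generic conditions always
  meet.\<close>

lemma vanishes_if_generically_vanishes:
  fixes F :: "('a::euclidean_space, 'b::euclidean_space) ratmap"
  assumes "rational_map UNIV F" "real_polynomial_function h"
    and "generically UNIV (\<lambda>u. h (rval F u) = 0)" and "u \<in> rdom F"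
  shows "h (rval F u) = 0"
proof (rule ccontr)
  assume "h (rval F u) \<noteq> 0"
  with assms have "generically UNIV (\<lambda>u. (u \<in> rdom F \<and> h (rval F u) \<noteq> 0) \<and> h (rval F u) = 0)"
    by (intro generically_conj generically_comp_nonzero)
  then show False
    by (auto dest: generically_ex)
qed

lemma generically_rdom: "rational_map V F \<Longrightarrow> generically V (\<lambda>u. u \<in> rdom F)"
  unfolding generically_def rational_map_def rdom_def by blast

text \<open>The inverse \<open>G\<close> supplies the one point needed: for a generic
  \<open>v\<close> with \<open>h v\<close> nonzero, \<open>F\<close> sends \<open>rval G v\<close>
  to \<open>v\<close>.\<close>

lemma birational_dominant:
  fixes F :: "('a::euclidean_space, 'b::euclidean_space) ratmap"
  assumes F: "birational UNIV UNIV F" and P: "generically UNIV P"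
  shows "generically UNIV (\<lambda>u. u \<in> rdom F \<and> P (rval F u))"
proof -
  obtain h b where h: "real_polynomial_function h" "h b \<noteq> 0" "\<And>v. h v \<noteq> 0 \<Longrightarrow> P v"
    using P unfolding generically_def by auto
  obtain G where G: "rat_left_inverse UNIV UNIV G F" and rF: "rational_map UNIV F"
    using F unfolding birational_def by blast
  have "generically UNIV (\<lambda>v. h v \<noteq> 0)"
    using h unfolding generically_def by auto
  with G obtain v where "rval G v \<in> rdom F" "rval F (rval G v) = v" "h v \<noteq> 0"
    unfolding rat_left_inverse_def by (blast dest: generically_ex[OF generically_conj])
  then have "generically UNIV (\<lambda>u. u \<in> rdom F \<and> h (rval F u) \<noteq> 0)"
    by (intro generically_comp_nonzero[OF rF h(1)]) auto
  then show ?thesis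
    by (rule generically_mono) (use h(3) in blast)
qed

section \<open>The closure of the image and its symmetries\<close>

lemma param_variety_incl:
  assumes "u \<in> rdom x"
  shows "rval x u \<in> param_variety x"
  using assms unfolding param_variety_def zariski_closure_def by blast

text \<open>Density of the image in its closure, used to trade a point of the variety for a
  parametrized one.\<close>

lemma param_variety_nonzero:
  assumes "real_polynomial_function h" "w \<in> param_variety x" "h w \<noteq> 0"
  obtains u where "u \<in> rdom x" "h (rval x u) \<noteq> 0"
  using assms unfolding param_variety_def zariski_closure_def by blast

lemma real_polynomial_comp:
  assumes "polynomial_function f" "real_polynomial_function h"
  shows "real_polynomial_function (\<lambda>v. h (f v))"
  using assms polynomial_function_compose[of f h] by (simp add: real_polynomial_function_eq o_def)

lemma generically_pullback:
  fixes x :: "('a::euclidean_space, 'b::euclidean_space) ratmap"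
  assumes x: "rational_map UNIV x" and f: "polynomial_function f"
    and fS: "f ` param_variety x = param_variety x"
    and P: "generically (param_variety x) P"
  shows "generically UNIV (\<lambda>u. u \<in> rdom x \<and> P (f (rval x u)))"
proof -
  obtain h v where h: "real_polynomial_function h" "v \<in> param_variety x" "h v \<noteq> 0"
    and hP: "\<And>v. v \<in> param_variety x \<Longrightarrow> h v \<noteq> 0 \<Longrightarrow> P v"
    using P unfolding generically_def by auto
  \<comment> \<open>Since \<open>f\<close> maps the variety onto itself, \<open>h\<close> composed
    with \<open>f\<close> cannot vanish on all of it.\<close>
  obtain w where "w \<in> param_variety x" "h (f w) \<noteq> 0"
    using h fS by (metis imageE)
  moreover have hf: "real_polynomial_function (\<lambda>v. h (f v))"
    using real_polynomial_comp[OF f] h by blast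
  ultimately obtain u where "u \<in> rdom x" "h (f (rval x u)) \<noteq> 0"
    using param_variety_nonzero[of "\<lambda>v. h (f v)"] by metis
  then have "generically UNIV (\<lambda>u. u \<in> rdom x \<and> h (f (rval x u)) \<noteq> 0)"
    using generically_comp_nonzero[OF x hf] by blast
  then show ?thesis
    by (rule generically_mono) (use hP param_variety_incl fS in blast)
qed

text \<open>The denominator of \<open>G\<close> could only spoil the composite by vanishing at
  \<open>f (rval x u)\<close> for all \<open>u\<close> in the domain of \<open>x\<close>;
  \<open>generically_pullback\<close> excludes this.\<close>

lemma rational_conjugate:
  fixes x :: "('a::euclidean_space, 'b::euclidean_space) ratmap" and G :: "('b, 'a) ratmap"
  assumes x: "rational_map UNIV x" and G: "rational_map (param_variety x) G"
    and f: "polynomial_function f" "f ` param_variety x = param_variety x"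
  obtains C :: "('a, 'a) ratmap" where "rational_map UNIV C"
    "rdom C = {u \<in> rdom x. f (rval x u) \<in> rdom G}"
    "\<And>u. u \<in> rdom C \<Longrightarrow> rval C u = rval G (f (rval x u))"
proof -
  define K where "K = (fst G \<circ> f, snd G \<circ> f)"
  have K: "polynomial_function (fst K)" "real_polynomial_function (snd K)"
    unfolding K_def fst_conv snd_conv
    by (rule polynomial_function_compose real_polynomial_function_compose, rule f,
        use G in \<open>simp add: rational_map_def\<close>)+
  have "polynomial_function (fst x)" "real_polynomial_function (snd x)"
    using x by (simp_all add: rational_map_def)
  from rational_comp[OF this K]
  obtain C :: "('a, 'a) ratmap" where C: "polynomial_function (fst C)"
      "real_polynomial_function (snd C)"
      "rdom C = {u \<in> rdom x. rval x u \<in> rdom K}"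
      "\<And>u. u \<in> rdom C \<Longrightarrow> rval C u = rval K (rval x u)"
    by blast
  have dC: "rdom C = {u \<in> rdom x. f (rval x u) \<in> rdom G}"
    unfolding C(3) by (simp add: K_def rdom_def)
  have "generically UNIV (\<lambda>u. u \<in> rdom x \<and> f (rval x u) \<in> rdom G)"
    using generically_pullback[OF x f generically_rdom[OF G]] .
  then have "\<exists>u. u \<in> rdom C"
    unfolding dC by (auto dest: generically_ex)
  then show thesis
    using C(1,2) C(4) dC
    by (intro that[of C]) (auto simp: rational_map_def rdom_def rval_def K_def)
qed

text \<open>Writing the maps as composites, E C = (G g x)(G f x) = G g f x = G x = id: first x G =
  id is used at \<open>f (rval x u)\<close>, then G x = id at \<open>u\<close>. Only
  \<open>g\<close> after \<open>f\<close> being the identity is assumed, so the roles of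
  \<open>f\<close> and \<open>g\<close> can be exchanged.\<close>

lemma rational_conjugate_left_inverse:
  fixes x :: "('a::euclidean_space, 'b::euclidean_space) ratmap" and G :: "('b, 'a) ratmap"
  assumes x: "rational_map UNIV x"
    and xG: "rat_left_inverse UNIV (param_variety x) x G"
      "rat_left_inverse (param_variety x) UNIV G x"
    and f: "polynomial_function f" "f ` param_variety x = param_variety x" "\<And>z. g (f z) = z"
    and C: "rdom C = {u \<in> rdom x. f (rval x u) \<in> rdom G}"
      "\<And>u. u \<in> rdom C \<Longrightarrow> rval C u = rval G (f (rval x u))"
    and E: "rdom E = {u \<in> rdom x. g (rval x u) \<in> rdom G}"
      "\<And>u. u \<in> rdom E \<Longrightarrow> rval E u = rval G (g (rval x u))"
  shows "rat_left_inverse UNIV UNIV C E"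
proof -
  have "generically UNIV (\<lambda>u. (u \<in> rdom x \<and> (f (rval x u) \<in> rdom G \<and>
      rval G (f (rval x u)) \<in> UNIV \<and> rval G (f (rval x u)) \<in> rdom x \<and>
      rval x (rval G (f (rval x u))) = f (rval x u))) \<and>
      (u \<in> rdom x \<and> rval x u \<in> param_variety x \<and> rval x u \<in> rdom G \<and> rval G (rval x u) = u))"
    using generically_pullback[OF x f(1,2) xG(2)[unfolded rat_left_inverse_def]]
      xG(1)[unfolded rat_left_inverse_def]
    by (rule generically_conj)
  then show ?thesis
    unfolding rat_left_inverse_def
    by (rule generically_mono) (simp add: C E f(3))
qed

lemma symmetry_imp_unique_lift:
  fixes x :: "('a::euclidean_space, 'b::euclidean_space) ratmap"
  assumes x: "birational UNIV (param_variety x) x"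
    and f: "polynomial_function f" and g: "polynomial_function g"
    and gf: "\<And>z. g (f z) = z" and fg: "\<And>z. f (g z) = z"
    and fS: "f ` param_variety x = param_variety x"
  shows "\<exists>\<phi>. birational UNIV UNIV \<phi> \<and> lifts_to f x \<phi> \<and>
    (\<forall>\<psi>. birational UNIV UNIV \<psi> \<and> lifts_to f x \<psi> \<longrightarrow> rat_eq UNIV \<psi> \<phi>)"
proof -
  obtain G where rx: "rational_map UNIV x" and rG: "rational_map (param_variety x) G"
    and xG: "rat_left_inverse UNIV (param_variety x) x G"
    and Gx: "rat_left_inverse (param_variety x) UNIV G x"
    using x unfolding birational_def by blast
  have "g ` f ` param_variety x = param_variety x"
    by (simp add: image_image gf)
  then have gS: "g ` param_variety x = param_variety x"
    unfolding fS .
  obtain \<phi> where rphi: "rational_map UNIV \<phi>"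
    and dphi: "rdom \<phi> = {u \<in> rdom x. f (rval x u) \<in> rdom G}"
    and vphi: "\<And>u. u \<in> rdom \<phi> \<Longrightarrow> rval \<phi> u = rval G (f (rval x u))"
    using rational_conjugate[OF rx rG f fS] by blast
  obtain \<tau> where rtau: "rational_map UNIV \<tau>"
    and dtau: "rdom \<tau> = {u \<in> rdom x. g (rval x u) \<in> rdom G}"
    and vtau: "\<And>u. u \<in> rdom \<tau> \<Longrightarrow> rval \<tau> u = rval G (g (rval x u))"
    using rational_conjugate[OF rx rG g gS] by blast
  \<comment> \<open>The two sides of the inverse come from the same lemma with \<open>f\<close> and
    \<open>g\<close> exchanged.\<close>
  have "birational UNIV UNIV \<phi>"
    unfolding birational_def
    using rphi rtau
      rational_conjugate_left_inverse[OF rx xG Gx f fS gf dphi vphi dtau vtau]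
      rational_conjugate_left_inverse[OF rx xG Gx g gS fg dtau vtau dphi vphi]
    by blast
  moreover have "lifts_to f x \<phi>"
    unfolding lifts_to_def
    using generically_pullback[OF rx f fS Gx[unfolded rat_left_inverse_def]]
    by (rule generically_mono) (simp add: dphi vphi)
  moreover have "rat_eq UNIV \<psi> \<phi>" if psi: "birational UNIV UNIV \<psi>" "lifts_to f x \<psi>" for \<psi>
  proof -
    \<comment> \<open>The identity G x = id is pulled back along \<psi>, which is legitimate because
      a birational map is dominant.\<close>
    have "generically UNIV (\<lambda>u. (u \<in> rdom \<psi> \<and> rval \<psi> u \<in> rdom x \<and>
        rval x (rval \<psi> u) \<in> param_variety x \<and> rval x (rval \<psi> u) \<in> rdom G \<and>
        rval G (rval x (rval \<psi> u)) = rval \<psi> u) \<and>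
        (u \<in> rdom x \<and> u \<in> rdom \<psi> \<and> rval \<psi> u \<in> rdom x \<and> f (rval x u) = rval x (rval \<psi> u)))"
      using birational_dominant[OF psi(1) xG[unfolded rat_left_inverse_def]]
        psi(2)[unfolded lifts_to_def]
      by (rule generically_conj)
    then show ?thesis
      unfolding rat_eq_def by (rule generically_mono) (simp add: dphi vphi)
  qed
  ultimately show ?thesis
    by blast
qed

section \<open>From a lift back to a symmetry\<close>

text \<open>If \<open>h\<close> vanishes on the image of \<open>x\<close>, then \<open>h\<close>
  after \<open>f\<close> vanishes at generic parametrized points, hence at all of them, hence on the
  closure.\<close>

lemma param_variety_subset_if_generically:
  fixes x :: "('a::euclidean_space, 'b::euclidean_space) ratmap"
  assumes x: "rational_map UNIV x" and f: "polynomial_function f"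
    and gen: "generically UNIV (\<lambda>u. f (rval x u) \<in> rval x ` rdom x)"
  shows "f ` param_variety x \<subseteq> param_variety x"
proof -
  have "h (f z) = 0"
    if z: "z \<in> param_variety x" and h: "real_polynomial_function h"
      and van: "\<forall>a\<in>rval x ` rdom x. h a = 0" for z h
  proof -
    have hf: "real_polynomial_function (\<lambda>v. h (f v))"
      using real_polynomial_comp[OF f] h by blast
    have "generically UNIV (\<lambda>u. h (f (rval x u)) = 0)"
      using gen by (rule generically_mono) (use van in blast)
    then have "h (f (rval x u)) = 0" if "u \<in> rdom x" for u
      using vanishes_if_generically_vanishes[OF x hf _ that] by blast
    with z hf show ?thesis
      using param_variety_nonzero[of "\<lambda>v. h (f v)" z x] by metis
  qed
  then show ?thesis
    unfolding param_variety_def zariski_closure_def by blast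
qed

lemma lift_imp_symmetry:
  fixes x :: "('a::euclidean_space, 'b::euclidean_space) ratmap"
  assumes x: "rational_map UNIV x"
    and f: "polynomial_function f" and g: "polynomial_function g"
    and gf: "\<And>z. g (f z) = z" and fg: "\<And>z. f (g z) = z"
    and phi: "birational UNIV UNIV \<phi>" "lifts_to f x \<phi>"
  shows "f ` param_variety x = param_variety x"
proof
  have "generically UNIV (\<lambda>u. f (rval x u) \<in> rval x ` rdom x)"
    using phi(2) unfolding lifts_to_def by (rule generically_mono) auto
  then show "f ` param_variety x \<subseteq> param_variety x"
    by (rule param_variety_subset_if_generically[OF x f])
  \<comment> \<open>The definition of \<open>birational\<close> is symmetric, so the inverse of
    \<phi> is birational too and hence dominant.\<close>
  obtain \<tau> where tau: "birational UNIV UNIV \<tau>" "rat_left_inverse UNIV UNIV \<tau> \<phi>"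
    using phi(1) unfolding birational_def by blast
  have "generically UNIV (\<lambda>u. (u \<in> rdom \<tau> \<and> rval \<tau> u \<in> rdom x \<and> rval \<tau> u \<in> rdom \<phi> \<and>
      rval \<phi> (rval \<tau> u) \<in> rdom x \<and> f (rval x (rval \<tau> u)) = rval x (rval \<phi> (rval \<tau> u))) \<and>
      (u \<in> rdom \<tau> \<and> rval \<tau> u \<in> UNIV \<and> rval \<tau> u \<in> rdom \<phi> \<and> rval \<phi> (rval \<tau> u) = u))"
    using birational_dominant[OF tau(1) phi(2)[unfolded lifts_to_def]]
      tau(2)[unfolded rat_left_inverse_def]
    by (rule generically_conj)
  \<comment> \<open>Along \<tau> the lift identity reads
    \<open>f (rval x (rval \<tau> u)) = rval x u\<close>; applying \<open>g\<close> exhibits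
    \<open>g (rval x u)\<close> as a point of the image.\<close>
  then have "generically UNIV (\<lambda>u. g (rval x u) \<in> rval x ` rdom x)"
    by (rule generically_mono) (metis gf imageI)
  then have "g ` param_variety x \<subseteq> param_variety x"
    by (rule param_variety_subset_if_generically[OF x g])
  then show "param_variety x \<subseteq> f ` param_variety x"
    using fg by (metis image_eqI image_subset_iff subsetI)
qed

theorem theorem2:
  fixes p q :: "(real, real^3) ratmap"
    and x :: "(real \<times> real, real^3) ratmap"
    and S :: "(real^3) set"
    and f :: "real^3 \<Rightarrow> real^3"
    and Q :: "real^3^3" and b :: "real^3"
  assumes "rational_map UNIV p" and "rational_map UNIV q"
    and "\<exists>t\<in>rdom q. rval q t \<noteq> 0"
    and "x = ruled_param p q"
    and "S = param_variety x"
    and proper: "birational UNIV S x"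
    and "orthogonal_matrix Q"
    and "f = (\<lambda>z. Q *v z + b)"
  shows "f ` S = S \<longleftrightarrow>
    (\<exists>\<phi> :: (real \<times> real, real \<times> real) ratmap.
       birational UNIV UNIV \<phi> \<and> lifts_to f x \<phi> \<and>
       (\<forall>\<psi>. birational UNIV UNIV \<psi> \<and> lifts_to f x \<psi> \<longrightarrow> rat_eq UNIV \<psi> \<phi>))"
proof -
  \<comment> \<open>The inverse isometry, the transpose of \<open>Q\<close> being its inverse by
    orthogonality.\<close>
  define g where "g = (\<lambda>z. transpose Q *v (z - b))"
  have linear: "polynomial_function ((*v) A)" for A :: "real^3^3"
    by (simp add: polynomial_function_bounded_linear)
  have f: "polynomial_function f"
    unfolding \<open>f = _\<close> by (intro polynomial_function_add linear polynomial_function_const)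
  have "polynomial_function ((*v) (transpose Q) \<circ> (\<lambda>z. z - b))"
    by (intro polynomial_function_compose polynomial_function_diff linear
        polynomial_function_id polynomial_function_const)
  then have g: "polynomial_function g"
    by (simp add: g_def o_def)
  have gf: "g (f z) = z" and fg: "f (g z) = z" for z
    using \<open>orthogonal_matrix Q\<close> unfolding g_def \<open>f = _\<close>
    \<comment> \<open>The deleted rule would turn \<open>transpose Q *v z\<close> into
      \<open>z v* Q\<close> and hide the product of \<open>Q\<close> with its transpose.\<close>
    by (simp_all add: matrix_vector_mul_assoc orthogonal_matrix_def del: transpose_matrix_vector)
  have "rational_map UNIV x"
    using proper unfolding birational_def by blast
  then show ?thesis
    using symmetry_imp_unique_lift[OF proper[unfolded \<open>S = _\<close>] f g gf fg]
      lift_imp_symmetry[OF _ f g gf fg]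
    unfolding \<open>S = _\<close> by blast
qed

end
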